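(* There exist a metric space $X$ (a subspace of a Euclidean space) and a fractal structure $\mathbf{\Gamma}$ on $X$ such that $\dim^3_{\mathbf{\Gamma}}(X)\neq\dim^5_{\mathbf{\Gamma}}(X)$ and $\dim^3_{\mathbf{\Gamma}}(X)\neq\dim^4_{\mathbf{\Gamma}}(X)$.
   Context: Fractal structures. A covering of a set $X$ is a family $\Gamma$ of subsets of $X$ with union $X$; the same set is allowed to appear several times in a covering, and sums over elements of a covering are taken with multiplicity. $\Gamma_1\prec\Gamma_2$ means that each $A\in\Gamma_1$ is contained in some $B\in\Gamma_2$; $\Gamma_1\prec\prec\Gamma_2$ means that $\Gamma_1\prec\Gamma_2$ and for all $B\in\Gamma_2$, $B=\bigcup\{A\in\Gamma_1:A\subseteq B\}$. A fractal structure on $X$ is a sequence $\mathbf{\Gamma}=\{\Gamma_n\}_{n\in\mathbb{N}}$ of coverings of $X$ with $\Gamma_{n+1}\prec\prec\Gamma_n$ for all $n$. Fractal dimensions III, IV, V. Let $\mathbf{\Gamma}$ be a fractal structure on a metric space $(X,\rho)$ and $F\subseteq X$ with $\delta(F,\Gamma_n)=\sup\{\operatorname{diam}(A):A\in\Gamma_n,\ A\cap F\neq\emptyset\}\to0$. For $k\in\{3,4,5\}$ and $s\ge0$ put $$\mathcal{H}^s_{n,k}(F)=\inf\Big\{\sum_{j\in J}\operatorname{diam}(A_j)^s:\{A_j\}_{j\in J}\in\mathcal{A}_{n,k}(F)\Big\},\qquad \mathcal{H}^s_k(F)=\lim_{n\to\infty}\mathcal{H}^s_{n,k}(F)$$ (with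 $\inf\emptyset=\infty$), where $\mathcal{A}_{n,3}(F)=\{\{A\in\Gamma_l:A\cap F\neq\emptyset\}:l\ge n\}$; $\mathcal{A}_{n,4}(F)$ is the collection of all finite families $\{A_j\}_{j\in J}$ of elements of $\bigcup_{l\ge n}\Gamma_l$ with $F\subseteq\bigcup_{j\in J}A_j$; $\mathcal{A}_{n,5}(F)$ is the same with countable families instead of finite ones. Then $\dim^k_{\mathbf{\Gamma}}(F)=\inf\{s:\mathcal{H}^s_k(F)=0\}=\sup\{s:\mathcal{H}^s_k(F)=\infty\}$. *)

theory Defs
  imports "HOL-Analysis.Analysis"
begin

text \<open>
  A family \<open>{A\<^sub>j}\<^sub>j\<^sub>\<in>\<^sub>J\<close> of subsets of \<open>'a\<close> is the pair \<open>(J, A)\<close>. Distinct indices may carry the same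
  set, so repetitions of a set in a family are recorded, and sums over the index set
  count sets with multiplicity.
\<close>
type_synonym ('i, 'a) family = "'i set \<times> ('i \<Rightarrow> 'a set)"

definition members :: "('i, 'a) family \<Rightarrow> 'a set set" where
  "members \<A> = snd \<A> ` fst \<A>"

definition covering :: "'a set \<Rightarrow> ('i, 'a) family \<Rightarrow> bool" where
  "covering X \<A> \<longleftrightarrow> \<Union> (members \<A>) = X"

definition refines :: "('i, 'a) family \<Rightarrow> ('j, 'a) family \<Rightarrow> bool" where
  "refines \<A> \<B> \<longleftrightarrow> (\<forall>A\<in>members \<A>. \<exists>B\<in>members \<B>. A \<subseteq> B)"

definition strongly_refines :: "('i, 'a) family \<Rightarrow> ('j, 'a) family \<Rightarrow> bool" where
  "strongly_refines \<A> \<B> \<longleftrightarrow>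
     refines \<A> \<B> \<and> (\<forall>B\<in>members \<B>. B = \<Union> {A \<in> members \<A>. A \<subseteq> B})"

definition fractal_structure :: "'a set \<Rightarrow> (nat \<Rightarrow> ('i, 'a) family) \<Rightarrow> bool" where
  "fractal_structure X \<Gamma> \<longleftrightarrow>
     (\<forall>n. covering X (\<Gamma> n)) \<and> (\<forall>n. strongly_refines (\<Gamma> (Suc n)) (\<Gamma> n))"

text \<open>
  Diameters take values in \<open>[0, \<infinity>]\<close>; the library's real-valued \<open>diameter\<close> is \<open>0\<close> on unbounded sets
  and is tied to the type class metric.
\<close>
definition ediam :: "('a \<Rightarrow> 'a \<Rightarrow> real) \<Rightarrow> 'a set \<Rightarrow> ennreal" where
  "ediam d A = (SUP x\<in>A. SUP y\<in>A. ennreal (d x y))"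

text \<open>
  The power \<open>a\<^sup>s\<close> for \<open>s \<ge> 0\<close>, with \<open>a\<^sup>0 = 1\<close> for every \<open>a\<close>. The convention for \<open>0\<^sup>0\<close> does not influence
  the dimensions below, since they are infima over \<open>s\<close>.
\<close>
definition epow :: "ennreal \<Rightarrow> real \<Rightarrow> ennreal" where
  "epow a s = (if s = 0 then 1 else if a = \<infinity> then \<infinity> else ennreal (enn2real a powr s))"

definition mesh :: "('a \<Rightarrow> 'a \<Rightarrow> real) \<Rightarrow> 'a set \<Rightarrow> ('i, 'a) family \<Rightarrow> ennreal" where
  "mesh d F \<A> = (SUP A\<in>{A \<in> members \<A>. A \<inter> F \<noteq> {}}. ediam d A)"

definition family_cost :: "('a \<Rightarrow> 'a \<Rightarrow> real) \<Rightarrow> real \<Rightarrow> ('i, 'a) family \<Rightarrow> ennreal" where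
  "family_cost d s \<A> = (\<Sum>\<^sub>\<infinity>j\<in>fst \<A>. epow (ediam d (snd \<A> j)) s)"

definition families3 :: "(nat \<Rightarrow> ('i, 'a) family) \<Rightarrow> 'a set \<Rightarrow> nat \<Rightarrow> ('i, 'a) family set" where
  "families3 \<Gamma> F n =
     (\<lambda>l. ({i \<in> fst (\<Gamma> l). snd (\<Gamma> l) i \<inter> F \<noteq> {}}, snd (\<Gamma> l))) ` {l. n \<le> l}"

text \<open>Subsets of \<open>nat\<close> suffice as index sets of finite and of countable families.\<close>
definition families5 :: "(nat \<Rightarrow> ('i, 'a) family) \<Rightarrow> 'a set \<Rightarrow> nat \<Rightarrow> (nat, 'a) family set" where
  "families5 \<Gamma> F n =
     {\<A>. members \<A> \<subseteq> (\<Union>l\<in>{l. n \<le> l}. members (\<Gamma> l)) \<and> F \<subseteq> \<Union> (members \<A>)}"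

definition families4 :: "(nat \<Rightarrow> ('i, 'a) family) \<Rightarrow> 'a set \<Rightarrow> nat \<Rightarrow> (nat, 'a) family set" where
  "families4 \<Gamma> F n = {\<A> \<in> families5 \<Gamma> F n. finite (fst \<A>)}"

text \<open>
  Infima are taken in \<open>ennreal\<close>, so the infimum of the empty set is \<open>\<infinity>\<close>. The limit exists because
  the sequence is increasing in \<open>n\<close> for the decreasing \<open>\<AA>\<close> used below.
\<close>
definition fractal_measure ::
    "('a \<Rightarrow> 'a \<Rightarrow> real) \<Rightarrow> (nat \<Rightarrow> ('i, 'a) family set) \<Rightarrow> real \<Rightarrow> ennreal" where
  "fractal_measure d \<AA> s = lim (\<lambda>n. INF \<A>\<in>\<AA> n. family_cost d s \<A>)"

definition critical_exponent ::
    "('a \<Rightarrow> 'a \<Rightarrow> real) \<Rightarrow> (nat \<Rightarrow> ('i, 'a) family set) \<Rightarrow> ennreal" where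
  "critical_exponent d \<AA> = Inf {ennreal s |s. 0 \<le> s \<and> fractal_measure d \<AA> s = 0}"

definition fractal_dim3 ::
    "('a \<Rightarrow> 'a \<Rightarrow> real) \<Rightarrow> (nat \<Rightarrow> ('i, 'a) family) \<Rightarrow> 'a set \<Rightarrow> ennreal" where
  "fractal_dim3 d \<Gamma> F = critical_exponent d (families3 \<Gamma> F)"

definition fractal_dim4 ::
    "('a \<Rightarrow> 'a \<Rightarrow> real) \<Rightarrow> (nat \<Rightarrow> ('i, 'a) family) \<Rightarrow> 'a set \<Rightarrow> ennreal" where
  "fractal_dim4 d \<Gamma> F = critical_exponent d (families4 \<Gamma> F)"

definition fractal_dim5 ::
    "('a \<Rightarrow> 'a \<Rightarrow> real) \<Rightarrow> (nat \<Rightarrow> ('i, 'a) family) \<Rightarrow> 'a set \<Rightarrow> ennreal" where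
  "fractal_dim5 d \<Gamma> F = critical_exponent d (families5 \<Gamma> F)"

text \<open>
  Euclidean \<open>N\<close>-space is the library's \<open>Euclidean_space N\<close>: functions \<open>nat \<Rightarrow> real\<close> vanishing from
  index \<open>N\<close> on. Here the dimension is a term and can be quantified existentially.
\<close>
definition euclidean_dist :: "nat \<Rightarrow> (nat \<Rightarrow> real) \<Rightarrow> (nat \<Rightarrow> real) \<Rightarrow> real" where
  "euclidean_dist N x y = L2_set (\<lambda>i. x i - y i) {..<N}"

lemma Metric_space_euclidean_dist:
  "Metric_space (topspace (Euclidean_space N)) (euclidean_dist N)"
proof
  fix x y z :: "nat \<Rightarrow> real"
  show "0 \<le> euclidean_dist N x y"
    by (simp add: euclidean_dist_def L2_set_nonneg)
  show "euclidean_dist N x y = euclidean_dist N y x"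
    by (simp add: euclidean_dist_def L2_set_def power2_commute)
  show "euclidean_dist N x y = 0 \<longleftrightarrow> x = y"
    if "x \<in> topspace (Euclidean_space N)" "y \<in> topspace (Euclidean_space N)"
  proof -
    have "x i = y i" if "\<forall>i<N. x i = y i" for i
      using that \<open>x \<in> _\<close> \<open>y \<in> _\<close>
      by (cases "i < N") (auto simp: topspace_Euclidean_space)
    then show ?thesis
      by (auto simp: euclidean_dist_def L2_set_eq_0_iff)
  qed
  show "euclidean_dist N x z \<le> euclidean_dist N x y + euclidean_dist N y z"
    using L2_set_triangle_ineq[of "\<lambda>i. x i - y i" "\<lambda>i. y i - z i" "{..<N}"]
    by (simp add: euclidean_dist_def)
qed

end

(* The null sequence 1, 1/2, 1/4, ... with its limit 0 is covered by a tail T n of diameter (1/2)^n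
   together with finitely many singletons, which cost nothing for s > 0; so dimensions IV and V do
   not exceed 1/2 (in fact they vanish). Dimension III has to use every element of a level, with
   multiplicity. If level n contains 2^n copies of T n, its cost is at least 2^n * (1/2)^(n s) >= 1
   for s <= 1, and dimension III is at least 1. *)
theory Submission
  imports Defs
begin

lemma ediam_singleton: "d x x = 0 \<Longrightarrow> ediam d {x} = 0"
  by (simp add: ediam_def)

lemma epow_0: "0 < s \<Longrightarrow> epow 0 s = 0"
  by (simp add: epow_def)

text \<open>On \<open>[0,1]\<close> a smaller exponent gives a larger power, here compared with
  exponent \<open>1\<close>. The cases \<open>s = 0\<close> and \<open>r = 0\<close> are split off
  because \<open>powr\<close> treats base \<open>0\<close> specially and \<open>epow\<close> sets
  every power with exponent \<open>0\<close> to \<open>1\<close>.\<close>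

lemma le_epow:
  assumes "0 \<le> r" "r \<le> 1" "0 \<le> s" "s \<le> 1"
  shows "ennreal r \<le> epow (ennreal r) s"
proof (cases "s = 0 \<or> r = 0")
  case False
  then have "r powr 1 \<le> r powr s"
    using assms by (intro powr_mono') auto
  with False assms show ?thesis
    by (simp add: epow_def)
qed (use assms in \<open>auto simp: epow_def\<close>)

text \<open>Arbitrarily cheap families at every stage make each infimum \<open>0\<close>, so the
  limit is \<open>0\<close> and \<open>s\<close> enters the infimum over exponents.\<close>

lemma critical_exponent_le:
  assumes "0 \<le> s" "\<And>n e. 0 < e \<Longrightarrow> \<exists>\<A>\<in>\<AA> n. family_cost d s \<A> \<le> ennreal e"
  shows "critical_exponent d \<AA> \<le> ennreal s"
proof -
  have "(INF \<A>\<in>\<AA> n. family_cost d s \<A>) = 0" for n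
  proof -
    have "(INF \<A>\<in>\<AA> n. family_cost d s \<A>) \<le> 0"
    proof (rule ennreal_le_epsilon)
      fix e :: real assume "0 < e"
      then obtain \<A> where "\<A> \<in> \<AA> n" "family_cost d s \<A> \<le> ennreal e"
        using assms(2) by blast
      then show "(INF \<A>\<in>\<AA> n. family_cost d s \<A>) \<le> 0 + ennreal e"
        by (auto intro: INF_lower2)
    qed
    then show ?thesis by simp
  qed
  then have "fractal_measure d \<AA> s = 0"
    by (simp add: fractal_measure_def limI)
  with assms(1) show ?thesis
    unfolding critical_exponent_def by (intro Inf_lower) auto
qed

lemma le_critical_exponent:
  assumes "decseq \<AA>"
    and "\<And>s n \<A>. 0 \<le> s \<Longrightarrow> s \<le> t \<Longrightarrow> \<A> \<in> \<AA> n \<Longrightarrow> 1 \<le> family_cost d s \<A>"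
  shows "ennreal t \<le> critical_exponent d \<AA>"
  unfolding critical_exponent_def
proof (rule Inf_greatest, clarify)
  fix s assume s: "0 \<le> s" "fractal_measure d \<AA> s = 0"
  let ?H = "\<lambda>n. INF \<A>\<in>\<AA> n. family_cost d s \<A>"
  have "incseq ?H"
    using assms(1) by (auto simp: incseq_def decseq_def intro!: INF_superset_mono)
  then have "fractal_measure d \<AA> s = (SUP n. ?H n)"
    unfolding fractal_measure_def by (intro limI LIMSEQ_SUP)
  \<comment> \<open>The limit is a supremum, so it dominates stage \<open>0\<close>; a single stage
    bounded below by \<open>1\<close> therefore rules out measure zero.\<close>
  with s have "?H 0 = 0"
    by (metis SUP_upper UNIV_I le_zero_eq)
  then have "\<not> 1 \<le> ?H 0"
    by simp
  then have "\<not> s \<le> t"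
    using assms(2)[OF s(1)] by (meson INF_greatest)
  then show "ennreal t \<le> ennreal s"
    by (simp add: ennreal_leI)
qed

lemma decseq_families3: "decseq (families3 \<Gamma> F)"
  by (auto simp: decseq_def families3_def)

definition pt :: "real \<Rightarrow> nat \<Rightarrow> real" where
  "pt t = (\<lambda>i. if i = 0 then t else 0)"

definition tail :: "nat \<Rightarrow> (nat \<Rightarrow> real) set" where
  "tail n = insert (pt 0) ((\<lambda>k. pt ((1/2) ^ k)) ` {n..})"

text \<open>An index is a set paired with a counter. The family map \<open>fst\<close> forgets the
  counter, so the counter serves only to create copies.\<close>

definition levels :: "nat \<Rightarrow> ((nat \<Rightarrow> real) set \<times> nat, nat \<Rightarrow> real) family" where
  "levels n = ({tail n} \<times> {..<2 ^ n} \<union> (\<lambda>x. ({x}, 0)) ` tail 0, fst)"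

lemma dist_pt: "euclidean_dist 1 (pt a) (pt b) = \<bar>a - b\<bar>"
  by (simp add: euclidean_dist_def pt_def L2_set_def)

lemma tail_0_subset: "tail 0 \<subseteq> topspace (Euclidean_space 1)"
  by (auto simp: tail_def pt_def topspace_Euclidean_space)

lemma decseq_tail: "decseq tail"
  by (auto simp: decseq_def tail_def)

text \<open>Only finitely many points have to be covered besides the tail; this makes a finite cover
  possible.\<close>

lemma tail_0_eq: "tail 0 = tail n \<union> (\<lambda>k. pt ((1/2) ^ k)) ` {..<n}"
proof -
  have "{0..} = {n..} \<union> {..<n}"
    by auto
  then show ?thesis
    unfolding tail_def by (metis Un_insert_left image_Un)
qed

lemma ediam_singleton_euclidean: "ediam (euclidean_dist N) {x} = 0"
  by (simp add: ediam_singleton euclidean_dist_def L2_set_def)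

lemma ediam_tail: "ediam (euclidean_dist 1) (tail n) = ennreal ((1/2) ^ n)"
proof (rule antisym)
  \<comment> \<open>The tail lies on a segment of length \<open>(1/2) ^ n\<close>. Its two endpoints
    belong to the tail, so the bound is attained.\<close>
  have eq: "\<exists>t. x = pt t \<and> 0 \<le> t \<and> t \<le> (1/2) ^ n" if "x \<in> tail n" for x
    using that unfolding tail_def
  proof (elim insertE imageE)
    show ?thesis if "x = pt 0"
      using that by (intro exI[of _ 0]) auto
    show ?thesis if "x = pt ((1/2) ^ k)" "k \<in> {n..}" for k
      using that by (intro exI[of _ "(1/2) ^ k"] conjI power_decreasing) auto
  qed
  have "euclidean_dist 1 x y \<le> (1/2) ^ n" if "x \<in> tail n" "y \<in> tail n" for x y
    using eq[OF that(1)] eq[OF that(2)] by (auto simp del: One_nat_def simp: dist_pt)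
  then show "ediam (euclidean_dist 1) (tail n) \<le> ennreal ((1/2) ^ n)"
    unfolding ediam_def by (intro SUP_least ennreal_leI)
  have "ennreal ((1/2) ^ n) = ennreal (euclidean_dist 1 (pt ((1/2) ^ n)) (pt 0))"
    unfolding dist_pt by simp
  also have "\<dots> \<le> ediam (euclidean_dist 1) (tail n)"
    unfolding ediam_def
    by (rule SUP_upper2[of "pt ((1/2) ^ n)"], simp add: tail_def)
       (rule SUP_upper, simp add: tail_def)
  finally show "ennreal ((1/2) ^ n) \<le> ediam (euclidean_dist 1) (tail n)" .
qed

text \<open>Copies collapse in the set of members, so covering, refinement and mesh do not see the
  multiplicity.\<close>

lemma members_levels: "members (levels n) = insert (tail n) ((\<lambda>x. {x}) ` tail 0)"
  by (simp add: members_def levels_def image_Un image_image lessThan_empty_iff)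

lemma fractal_structure_levels: "fractal_structure (tail 0) levels"
proof -
  have sub: "tail n \<subseteq> tail 0" "tail (Suc n) \<subseteq> tail n" for n
    using decseq_tail by (simp_all add: decseq_def)
  have "covering (tail 0) (levels n)" for n
    using sub by (auto simp: covering_def members_levels)
  moreover have "strongly_refines (levels (Suc n)) (levels n)" for n
  proof -
    have "refines (levels (Suc n)) (levels n)"
      using sub by (auto simp: refines_def members_levels)
    moreover have "B = \<Union> {A \<in> members (levels (Suc n)). A \<subseteq> B}"
      if "B \<in> members (levels n)" for B
    proof -
      \<comment> \<open>Each level contains the singletons of all points of the space, so any
        \<open>B\<close> inside the space is the union of the singletons it contains.\<close>
      have "B \<subseteq> tail 0"
        using that sub by (auto simp: members_levels)
      then show ?thesis
        by (auto simp: members_levels intro!: exI[of _ "{_}"])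
    qed
    ultimately show ?thesis
      by (simp add: strongly_refines_def)
  qed
  ultimately show ?thesis
    by (simp add: fractal_structure_def)
qed

lemma ennreal_half_powers_tendsto_0: "(\<lambda>n. ennreal ((1/2) ^ n)) \<longlonglongrightarrow> 0"
  using tendsto_ennrealI[OF LIMSEQ_power_zero[of "1/2::real"]] by simp

lemma mesh_levels_tendsto_0: "(\<lambda>n. mesh (euclidean_dist 1) F (levels n)) \<longlonglongrightarrow> 0"
proof (rule tendsto_sandwich[OF _ _ tendsto_const ennreal_half_powers_tendsto_0])
  show "\<forall>\<^sub>F n in sequentially. mesh (euclidean_dist 1) F (levels n) \<le> ennreal ((1/2) ^ n)"
    unfolding mesh_def
    by (intro always_eventually allI SUP_least)
       (auto simp del: One_nat_def simp: members_levels ediam_tail ediam_singleton_euclidean)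
qed simp

lemma fractal_dim3_levels: "1 \<le> fractal_dim3 (euclidean_dist 1) levels (tail 0)"
proof -
  have "1 \<le> family_cost (euclidean_dist 1) s \<A>"
    if s: "0 \<le> s" "s \<le> 1" and \<A>: "\<A> \<in> families3 levels (tail 0) n" for s n \<A>
  proof -
    let ?c = "\<lambda>j. epow (ediam (euclidean_dist 1) (fst j)) s"
    from \<A> obtain l where l:
      "\<A> = ({i \<in> fst (levels l). snd (levels l) i \<inter> tail 0 \<noteq> {}}, snd (levels l))"
      by (auto simp: families3_def)
    \<comment> \<open>Since the tail meets the space, \<open>families3\<close> retains all
      \<open>2 ^ l\<close> of its copies.\<close>
    have "pt 0 \<in> tail l \<inter> tail 0"
      by (simp add: tail_def)
    then have sub: "{tail l} \<times> {..<2 ^ l} \<subseteq> fst \<A>" and snd: "snd \<A> = fst"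
      by (auto simp: l levels_def)
    have "1 = ennreal (2 ^ l * (1/2) ^ l)"
      by (simp add: power_one_over)
    also have "\<dots> = (\<Sum>j\<in>{tail l} \<times> {..<2 ^ l::nat}. ennreal ((1/2) ^ l))"
      by (simp add: card_cartesian_product ennreal_mult flip: ennreal_power)
    also have "\<dots> \<le> (\<Sum>j\<in>{tail l} \<times> {..<2 ^ l::nat}. ?c j)"
      using s by (intro sum_mono)
        (auto simp del: One_nat_def simp: ediam_tail power_le_one intro!: le_epow)
    also have "\<dots> = (\<Sum>\<^sub>\<infinity>j\<in>{tail l} \<times> {..<2 ^ l::nat}. ?c j)"
      by simp
    \<comment> \<open>The remaining indices, those of the singletons, only add nonnegative
      terms.\<close>
    also have "\<dots> \<le> (\<Sum>\<^sub>\<infinity>j\<in>fst \<A>. ?c j)"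
      using sub by (intro infsum_mono_neutral nonneg_summable_on_complete) auto
    also have "\<dots> = family_cost (euclidean_dist 1) s \<A>"
      by (simp add: family_cost_def snd)
    finally show ?thesis .
  qed
  then have "ennreal 1 \<le> fractal_dim3 (euclidean_dist 1) levels (tail 0)"
    unfolding fractal_dim3_def
    by (intro le_critical_exponent decseq_families3)
  then show ?thesis by simp
qed

text \<open>Here one copy of the tail is enough, and its cost \<open>((1/2) powr s) ^ m\<close>
  tends to \<open>0\<close> because \<open>s\<close> is positive.\<close>

lemma cheap_finite_family:
  assumes "0 < s" "0 < e"
  shows "\<exists>\<A>\<in>families4 levels (tail 0) n. family_cost (euclidean_dist 1) s \<A> \<le> ennreal e"
proof -
  have "(1/2) powr s < (1::real)"
    using powr_less_mono'[of "1/2" 0 s] assms by simp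
  then have "(\<lambda>m. ((1/2) powr s) ^ m) \<longlonglongrightarrow> (0::real)"
    by (intro LIMSEQ_power_zero) auto
  then have "\<forall>\<^sub>F m in sequentially. ((1/2) powr s) ^ m < e"
    using assms by (intro order_tendstoD) auto
  then obtain m where m: "n \<le> m" "((1/2) powr s) ^ m < e"
    using eventually_conj[OF eventually_ge_at_top[of n]]
    by (metis (mono_tags, lifting) eventually_happens' sequentially_bot)
  \<comment> \<open>Index \<open>0\<close> carries the tail, and indices \<open>1\<close> to
    \<open>m\<close> carry the points with exponents \<open>k < m\<close> split off by
    \<open>tail_0_eq\<close>.\<close>
  define S where "S j = (case j of 0 \<Rightarrow> tail m | Suc k \<Rightarrow> {pt ((1/2) ^ k)})" for j
  define \<A> where "\<A> = ({..m}, S)"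
  have mem: "members \<A> = insert (tail m) ((\<lambda>k. {pt ((1/2) ^ k)}) ` {..<m})"
    by (simp add: members_def \<A>_def S_def lessThan_Suc_eq_insert_0 image_image
        flip: lessThan_Suc_atMost)
  have "members \<A> \<subseteq> members (levels m)"
    by (auto simp: mem members_levels tail_0_eq[of m])
  moreover have "tail 0 \<subseteq> \<Union> (members \<A>)"
    by (auto simp: mem tail_0_eq[of m])
  ultimately have "\<A> \<in> families4 levels (tail 0) n"
    using m(1) by (auto simp: families4_def families5_def \<A>_def)
  moreover have "family_cost (euclidean_dist 1) s \<A>
      = epow (ediam (euclidean_dist 1) (tail m)) s"
  proof -
    have "family_cost (euclidean_dist 1) s \<A>
        = (\<Sum>j\<le>m. epow (ediam (euclidean_dist 1) (S j)) s)"
      by (simp add: family_cost_def \<A>_def)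
    \<comment> \<open>Singletons have diameter \<open>0\<close>, and \<open>epow 0 s\<close> is
      \<open>0\<close> for positive \<open>s\<close>, so only the tail contributes.\<close>
    also have "\<dots> = epow (ediam (euclidean_dist 1) (S 0)) s"
      using assms
      by (subst sum.remove[of _ 0])
         (auto simp: S_def ediam_singleton_euclidean epow_0 split: nat.split intro!: sum.neutral)
    finally show ?thesis
      by (simp add: S_def)
  qed
  moreover have "\<dots> = ennreal (((1/2) powr s) ^ m)"
  proof -
    have "((1/2) ^ m) powr s = ((1/2::real) powr s) ^ m"
      by (simp only: powr_realpow[symmetric] powr_powr powr_power mult.commute)
    then show ?thesis
      using assms unfolding ediam_tail by (simp add: epow_def)
  qed
  ultimately show ?thesis
    using m(2) by (intro bexI[of _ \<A>]) (auto intro: ennreal_leI)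
qed

theorem mainTheorem9:
  "\<exists>(N::nat) (X::(nat \<Rightarrow> real) set)
     (\<Gamma>::nat \<Rightarrow> ((nat \<Rightarrow> real) set \<times> nat, nat \<Rightarrow> real) family).
     X \<subseteq> topspace (Euclidean_space N) \<and>
     Metric_space X (euclidean_dist N) \<and>
     fractal_structure X \<Gamma> \<and>
     (\<lambda>n. mesh (euclidean_dist N) X (\<Gamma> n)) \<longlonglongrightarrow> 0 \<and>
     fractal_dim3 (euclidean_dist N) \<Gamma> X \<noteq> fractal_dim5 (euclidean_dist N) \<Gamma> X \<and>
     fractal_dim3 (euclidean_dist N) \<Gamma> X \<noteq> fractal_dim4 (euclidean_dist N) \<Gamma> X"
proof -
  let ?d = "euclidean_dist 1" and ?X = "tail 0"
  \<comment> \<open>The value \<open>1/2\<close> is an arbitrary separator: any exponent strictly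
    between \<open>0\<close> and \<open>1\<close> would do.\<close>
  have lt: "ennreal (1/2) < 1"
    by (subst ennreal_1[symmetric], subst ennreal_less_iff) auto
  have "fractal_dim4 ?d levels ?X \<le> ennreal (1/2)"
    unfolding fractal_dim4_def by (intro critical_exponent_le cheap_finite_family) auto
  then have 4: "fractal_dim4 ?d levels ?X < fractal_dim3 ?d levels ?X"
    using lt fractal_dim3_levels by order
  \<comment> \<open>A finite cover is also a countable one, so the same cheap families bound
    dimension V.\<close>
  have "\<exists>\<A>\<in>families5 levels ?X n. family_cost ?d (1/2) \<A> \<le> ennreal e" if "0 < e" for n e
    using cheap_finite_family[of "1/2" e n] that unfolding families4_def by auto
  then have "fractal_dim5 ?d levels ?X \<le> ennreal (1/2)"
    unfolding fractal_dim5_def by (intro critical_exponent_le) auto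
  then have 5: "fractal_dim5 ?d levels ?X < fractal_dim3 ?d levels ?X"
    using lt fractal_dim3_levels by order
  have "Metric_space ?X ?d"
    using Metric_space.subspace[OF Metric_space_euclidean_dist tail_0_subset] .
  with 4 5 tail_0_subset fractal_structure_levels mesh_levels_tendsto_0 show ?thesis
    by (intro exI[of _ 1] exI[of _ ?X] exI[of _ levels]) (auto simp del: One_nat_def)
qed

end
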